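(* Let $n_u,n_x,n_y\ge 1$ be integers. Let $W_f,W_i,W_c,W_o\in\mathbb{R}^{n_x\times n_u}$, $U_f,U_i,U_c,U_o\in\mathbb{R}^{n_x\times n_x}$, $b_f,b_i,b_o\in\mathbb{R}^{n_x}$, $C\in\mathbb{R}^{n_y\times n_x}$, $b_y\in\mathbb{R}^{n_y}$ be fixed, and consider the LSTM network $$x(k+1)=\sigma_g(W_f u(k)+U_f\xi(k)+b_f)\circ x(k)+\sigma_g(W_i u(k)+U_i\xi(k)+b_i)\circ\sigma_c(W_c u(k)+U_c\xi(k)+b_c),$$ $$\xi(k+1)=\sigma_g(W_o u(k)+U_o\xi(k)+b_o)\circ\sigma_c(x(k+1)),$$ $$y(k)=C\xi(k)+b_y,$$ with inputs $u(k)\in\mathcal{U}=[-1,1]^{n_u}$, state $\chi(k)=\begin{bmatrix}x(k)^T&\xi(k)^T\end{bmatrix}^T\in\mathbb{R}^{2n_x}$, and with $b_c\in\mathbb{R}^{n_x}$ regarded as a constant input. If $$\bigl(1+\sigma_g(|\begin{bmatrix}W_o&U_o&b_o\end{bmatrix}|_\infty)\bigr)\,\sigma_g(|\begin{bmatrix}W_f&U_f&b_f\end{bmatrix}|_\infty)<1$$ and $$\bigl(1+\sigma_g(|\begin{bmatrix}W_o&U_o&b_o\end{bmatrix}|_\infty)\bigr)\,\sigma_g(|\begin{bmatrix}W_i&U_i&b_i\end{bmatrix}|_\infty)\,|U_c|_1<1,$$ then the network is Input-to-State stable with respect to $u\in\mathcal{U}$ and $b_c$; that is, there exist functions $\beta\in\mathcal{KL}$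 and $\gamma_u,\gamma_b\in\mathcal{K}_\infty$ such that for every $k\in\mathbb{Z}_{\ge 0}$, every initial condition $\chi_0\in\mathbb{R}^{2n_x}$, every $b_c\in\mathbb{R}^{n_x}$, and every input sequence $\mathbf{u}=u(0),u(1),\dots$ with $u(j)\in\mathcal{U}$ for all $j$, $$|\chi(k,\chi_0,\mathbf{u},b_c)|_2\le\beta(|\chi_0|_2,k)+\gamma_u(\|\mathbf{u}\|_\infty)+\gamma_b(|b_c|_2).$$
   Context: Notation. $\sigma_g(t)=\frac{1}{1+e^{-t}}$ (sigmoid) and $\sigma_c(t)=\tanh(t)$ for $t\in\mathbb{R}$; when applied to a vector they act componentwise. $\circ$ is the Hadamard (componentwise) product. For a vector $v$, $|v|_2$ is the Euclidean norm. For a real matrix $A$ and $p\in\{1,\infty\}$, $|A|_p$ is the operator norm induced by the vector $p$-norm (so $|A|_\infty$ is the maximum absolute row sum and $|A|_1$ the maximum absolute column sum). $\begin{bmatrix}W&U&b\end{bmatrix}$ denotes horizontal concatenation, an $n_x\times(n_u+n_x+1)$ matrix. For a sequence $\mathbf{v}=v(0),v(1),\dots$ of vectors, $\|\mathbf{v}\|_\infty=\sup_{k\in\mathbb{N}}|v(k)|_2$. $\chi(k,\chi_0,\mathbf{u},b_c)$ denotes the state $\chi(k)$ at time $k$ of the system started at $\chi(0)=\chi_0$, fed by the input sequence $\mathbf{u}$ and with constant bias $b_c$. Comparison functions. $\gamma:\mathbb{R}_{\ge0}\to\mathbb{R}_{\ge0}$ is of class $\mathcal{K}$ if it is continuous,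 strictly increasing and $\gamma(0)=0$; it is of class $\mathcal{K}_\infty$ if moreover $\gamma(s)\to\infty$ as $s\to\infty$. $\beta:\mathbb{R}_{\ge0}\times\mathbb{R}_{\ge0}\to\mathbb{R}_{\ge0}$ is of class $\mathcal{KL}$ if $\beta(\cdot,t)$ is of class $\mathcal{K}$ for each fixed $t\ge0$, and for each fixed $s\ge0$ the function $\beta(s,\cdot)$ is decreasing (non-strictly) with $\beta(s,t)\to0$ as $t\to\infty$. *)

theory Defs
  imports "HOL-Analysis.Analysis"
begin

definition sigmoid :: "real \<Rightarrow> real" where
  "sigmoid t = 1 / (1 + exp (- t))"

definition map_vec :: "(real \<Rightarrow> real) \<Rightarrow> real ^ 'n \<Rightarrow> real ^ 'n" where
  "map_vec f v = (\<chi> i. f (v $ i))"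

definition norm1 :: "real ^ 'n \<Rightarrow> real" where
  "norm1 v = (\<Sum>i\<in>UNIV. \<bar>v $ i\<bar>)"

text \<open>The operator norm of a matrix induced by a norm on its domain and a norm on its codomain,
  in the style of \<^const>\<open>onorm\<close>: the term for the zero vector is \<open>0 / 0 = 0\<close> and does not affect
  the supremum.  The two arguments are separate only because the two spaces have different types.\<close>

definition induced_norm ::
    "(real ^ 'n \<Rightarrow> real) \<Rightarrow> (real ^ 'm \<Rightarrow> real) \<Rightarrow> real ^ 'n ^ 'm \<Rightarrow> real" where
  "induced_norm dom_norm cod_norm A = (SUP v. cod_norm (A *v v) / dom_norm v)"

abbreviation matrix_norm_1 :: "real ^ 'n ^ 'm \<Rightarrow> real" where
  "matrix_norm_1 \<equiv> induced_norm norm1 norm1"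

abbreviation matrix_norm_inf :: "real ^ 'n ^ 'm \<Rightarrow> real" where
  "matrix_norm_inf \<equiv> induced_norm infnorm infnorm"

text \<open>The horizontal concatenation \<open>[W U b]\<close>; its columns are indexed by a disjoint sum of the
  column indices of the three blocks.\<close>

definition hconcat ::
    "real ^ 'u ^ 'x \<Rightarrow> real ^ 'x ^ 'x \<Rightarrow> real ^ 'x \<Rightarrow> real ^ ('u + 'x + unit) ^ 'x" where
  "hconcat W U b =
    (\<chi> i j. case j of Inl l \<Rightarrow> W $ i $ l | Inr (Inl l) \<Rightarrow> U $ i $ l | Inr (Inr _) \<Rightarrow> b $ i)"

text \<open>Functions on the nonnegative reals are represented by functions on all reals of which only
  the values at nonnegative arguments matter.\<close>

definition class_K :: "(real \<Rightarrow> real) \<Rightarrow> bool" where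
  "class_K g \<longleftrightarrow>
    (\<forall>s\<ge>0. 0 \<le> g s) \<and> continuous_on {0..} g \<and> strict_mono_on {0..} g \<and> g 0 = 0"

definition class_Kinf :: "(real \<Rightarrow> real) \<Rightarrow> bool" where
  "class_Kinf g \<longleftrightarrow> class_K g \<and> filterlim g at_top at_top"

definition class_KL :: "(real \<Rightarrow> real \<Rightarrow> real) \<Rightarrow> bool" where
  "class_KL \<beta> \<longleftrightarrow>
    (\<forall>t\<ge>0. class_K (\<lambda>s. \<beta> s t)) \<and>
    (\<forall>s\<ge>0. antimono_on {0..} (\<beta> s) \<and> (\<beta> s \<longlongrightarrow> 0) at_top)"

definition seq_norm :: "(nat \<Rightarrow> real ^ 'n) \<Rightarrow> real" where
  "seq_norm v = (SUP k. norm (v k))"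

definition input_set :: "(real ^ 'u) set" where
  "input_set = {u. \<forall>i. u $ i \<in> {-1..1}}"

text \<open>The fixed parameters of the network.  The bias \<open>b\<^sub>c\<close> is not among them, as it is an input.\<close>

record ('u, 'x, 'y) lstm =
  W_f :: "real ^ 'u ^ 'x"
  W_i :: "real ^ 'u ^ 'x"
  W_c :: "real ^ 'u ^ 'x"
  W_o :: "real ^ 'u ^ 'x"
  U_f :: "real ^ 'x ^ 'x"
  U_i :: "real ^ 'x ^ 'x"
  U_c :: "real ^ 'x ^ 'x"
  U_o :: "real ^ 'x ^ 'x"
  b_f :: "real ^ 'x"
  b_i :: "real ^ 'x"
  b_o :: "real ^ 'x"
  C_y :: "real ^ 'x ^ 'y"
  b_y :: "real ^ 'y"

text \<open>The state space is the product of two copies of the Euclidean space of dimension \<open>CARD('x)\<close>;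
  the norm of a pair is the Euclidean norm of the stacked vector (fact \<open>norm_Pair\<close>).  The product
  \<open>*\<close> of two vectors is the componentwise one.\<close>

definition lstm_step ::
    "('u::finite, 'x::finite, 'y::finite) lstm \<Rightarrow> real ^ 'u \<Rightarrow> real ^ 'x
      \<Rightarrow> (real ^ 'x) \<times> (real ^ 'x) \<Rightarrow> (real ^ 'x) \<times> (real ^ 'x)" where
  "lstm_step N u b_c = (\<lambda>(x, \<xi>).
    let x' = map_vec sigmoid (W_f N *v u + U_f N *v \<xi> + b_f N) * x
           + map_vec sigmoid (W_i N *v u + U_i N *v \<xi> + b_i N)
             * map_vec tanh (W_c N *v u + U_c N *v \<xi> + b_c)
    in (x', map_vec sigmoid (W_o N *v u + U_o N *v \<xi> + b_o N) * map_vec tanh x'))"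

primrec lstm_state ::
    "('u::finite, 'x::finite, 'y::finite) lstm \<Rightarrow> nat \<Rightarrow> (real ^ 'x) \<times> (real ^ 'x)
      \<Rightarrow> (nat \<Rightarrow> real ^ 'u) \<Rightarrow> real ^ 'x \<Rightarrow> (real ^ 'x) \<times> (real ^ 'x)" where
  "lstm_state N 0 \<chi>\<^sub>0 u b_c = \<chi>\<^sub>0"
| "lstm_state N (Suc k) \<chi>\<^sub>0 u b_c = lstm_step N (u k) b_c (lstm_state N k \<chi>\<^sub>0 u b_c)"

definition lstm_output ::
    "('u::finite, 'x::finite, 'y::finite) lstm \<Rightarrow> nat \<Rightarrow> (real ^ 'x) \<times> (real ^ 'x)
      \<Rightarrow> (nat \<Rightarrow> real ^ 'u) \<Rightarrow> real ^ 'x \<Rightarrow> real ^ 'y" where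
  "lstm_output N k \<chi>\<^sub>0 u b_c = C_y N *v snd (lstm_state N k \<chi>\<^sub>0 u b_c) + b_y N"

end

theory Submission imports Defs begin

text \<open>The function \<open>V(x, \<xi>) = |x|\<^sub>1 + |\<xi>|\<^sub>1\<close> is a Lyapunov function.  As \<open>|\<sigma>\<^sub>c(t)| \<le> min(1, |t|)\<close>, after
  the first step all entries of \<open>\<xi>\<close> lie in \<open>[-1, 1]\<close>, so that the gates are bounded by the sigmoids of
  the norms in the hypotheses, and one step maps \<open>V\<close> to at most \<open>\<rho> V + 2 (|W\<^sub>c u|\<^sub>1 + |b\<^sub>c|\<^sub>1)\<close>, where
  \<open>\<rho> < 1\<close> is the larger of the left-hand sides of the two hypotheses.  In the first step, where
  \<open>\<xi>\<close> is arbitrary, the gates are only bounded by 1; this costs a constant factor.\<close>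

section \<open>Elementary bounds for the activation functions\<close>

lemma sigmoid_pos: "0 < sigmoid t"
  unfolding sigmoid_def by (simp add: add_pos_pos)

lemma sigmoid_le_1: "sigmoid t \<le> 1"
  unfolding sigmoid_def by (simp add: add_pos_pos)

lemma sigmoid_mono: "s \<le> t \<Longrightarrow> sigmoid s \<le> sigmoid t"
  unfolding sigmoid_def by (intro divide_left_mono mult_pos_pos) (auto intro: add_pos_pos)

lemma abs_tanh_le_1: "\<bar>tanh (t::real)\<bar> \<le> 1"
  using tanh_real_bounds[of t] by auto

text \<open>Mean value inequality between 0 and \<open>t\<close>: the derivative
  \<open>1 - (tanh z)\<^sup>2\<close> lies in [0, 1] because
  \<open>\<bar>tanh z\<bar> \<le> 1\<close>.\<close>

lemma abs_tanh_le_abs: "\<bar>tanh t\<bar> \<le> \<bar>t::real\<bar>"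
proof -
  have "norm (tanh t - tanh 0) \<le> 1 * norm (t - 0)"
  proof (rule field_differentiable_bound[where S = UNIV and f' = "\<lambda>z. 1 - (tanh z)\<^sup>2"])
    fix z :: real
    show "(tanh has_field_derivative 1 - (tanh z)\<^sup>2) (at z within UNIV)"
      by (auto intro!: derivative_eq_intros)
    show "norm (1 - (tanh z)\<^sup>2) \<le> 1"
      using abs_tanh_le_1[of z] by (simp add: abs_square_le_1)
  qed auto
  then show ?thesis by simp
qed

section \<open>The 1-norm and the Euclidean norm\<close>

lemma norm1_nonneg: "0 \<le> norm1 v"
  unfolding norm1_def by (simp add: sum_nonneg)

lemma norm1_triangle: "norm1 (v + w) \<le> norm1 v + norm1 w"
  unfolding norm1_def sum.distrib[symmetric]
  by (intro sum_mono) (simp add: abs_triangle_ineq)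

lemma norm_le_norm1: "norm (v :: real ^ 'n::finite) \<le> norm1 v"
  unfolding norm1_def by (rule norm_le_l1_cart)

text \<open>Each entry is at most the Euclidean norm. The sharp factor is the square root of
  \<open>CARD('n)\<close>; the cruder one is enough for the existence of gains.\<close>

lemma norm1_le_norm: "norm1 (v :: real ^ 'n::finite) \<le> CARD('n) * norm v"
  unfolding norm1_def using sum_bounded_above[of UNIV "\<lambda>i. \<bar>v $ i\<bar>" "norm v"]
  by (simp add: component_le_norm_cart)

section \<open>Operator norms of matrices\<close>

lemma norm_matrix_vector_mult_le:
  "norm ((A :: real ^ 'n::finite ^ 'm::finite) *v v) \<le> onorm ((*v) A) * norm v"
  by (rule onorm) (rule matrix_vector_mul_bounded_linear)

lemma norm1_matrix_vector_mult_le: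
  "norm1 ((A :: real ^ 'n::finite ^ 'm::finite) *v v) \<le> CARD('m) * onorm ((*v) A) * norm v"
  unfolding mult.assoc
  by (rule order_trans[OF norm1_le_norm]) (intro mult_left_mono norm_matrix_vector_mult_le; simp)

lemma onorm_matrix_nonneg: "0 \<le> onorm ((*v) (A :: real ^ 'n::finite ^ 'm::finite))"
  by (rule onorm_pos_le) (rule matrix_vector_mul_bounded_linear)

context
  fixes dom_norm :: "real ^ 'n::finite \<Rightarrow> real" and cod_norm :: "real ^ 'm::finite \<Rightarrow> real"
    and A :: "real ^ 'n ^ 'm" and K :: real
  assumes dom: "\<And>v. 0 \<le> dom_norm v" and cod: "\<And>v. 0 \<le> cod_norm v"
    and bound: "\<And>v. cod_norm (A *v v) \<le> K * dom_norm v"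
begin

text \<open>A supremum of reals is informative only for a set bounded above. The absolute value of
  \<open>K\<close> also covers the quotient 0 that arises where \<open>dom_norm\<close>
  vanishes.\<close>

lemma bdd_above_induced_norm: "bdd_above (range (\<lambda>v. cod_norm (A *v v) / dom_norm v))"
proof (rule bdd_aboveI2)
  fix v
  show "cod_norm (A *v v) / dom_norm v \<le> \<bar>K\<bar>"
  proof (cases "dom_norm v = 0")
    case False
    have "K * dom_norm v \<le> \<bar>K\<bar> * dom_norm v"
      using dom by (intro mult_right_mono) auto
    then have "cod_norm (A *v v) \<le> \<bar>K\<bar> * dom_norm v"
      using bound[of v] by linarith
    with False dom[of v] show ?thesis by (simp add: divide_le_eq)
  qed simp
qed

lemma induced_norm_nonneg: "0 \<le> induced_norm dom_norm cod_norm A"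
proof -
  have "0 \<le> cod_norm (A *v 0) / dom_norm 0"
    using dom cod by simp
  also have "\<dots> \<le> induced_norm dom_norm cod_norm A"
    unfolding induced_norm_def by (intro cSUP_upper bdd_above_induced_norm) simp
  finally show ?thesis .
qed

lemma induced_norm_bound: "cod_norm (A *v v) \<le> induced_norm dom_norm cod_norm A * dom_norm v"
proof (cases "dom_norm v = 0")
  case True
  \<comment> \<open>Division by zero makes the quotient 0, which says nothing about
    \<open>A *v v\<close>; here \<open>bound\<close> itself yields
    \<open>cod_norm (A *v v) \<le> 0\<close>.\<close>
  then show ?thesis using bound[of v] by simp
next
  case False
  have "cod_norm (A *v v) / dom_norm v \<le> induced_norm dom_norm cod_norm A"
    unfolding induced_norm_def by (intro cSUP_upper bdd_above_induced_norm) simp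
  then show ?thesis using False dom[of v] by (simp add: divide_le_eq)
qed

end

text \<open>Equivalence of norms in finite dimension gives some finite constant, so that the
  supremum in \<open>matrix_norm_1\<close> is taken over a bounded set.\<close>

lemma norm1_matrix_vector_mult_le_norm1:
  fixes A :: "real ^ 'n::finite ^ 'm::finite"
  shows "norm1 (A *v v) \<le> (CARD('m) * onorm ((*v) A)) * norm1 v"
  by (rule order_trans[OF norm1_matrix_vector_mult_le])
    (intro mult_left_mono norm_le_norm1 mult_nonneg_nonneg onorm_matrix_nonneg; simp)

lemma matrix_norm_1_nonneg: "0 \<le> matrix_norm_1 (A :: real ^ 'n::finite ^ 'm::finite)"
  by (rule induced_norm_nonneg) (rule norm1_nonneg norm1_matrix_vector_mult_le_norm1)+

lemma matrix_norm_1_bound: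
  "norm1 ((A :: real ^ 'n::finite ^ 'm::finite) *v v) \<le> matrix_norm_1 A * norm1 v"
  by (rule induced_norm_bound) (rule norm1_nonneg norm1_matrix_vector_mult_le_norm1)+

lemma infnorm_matrix_vector_mult_le_infnorm:
  fixes A :: "real ^ 'n::finite ^ 'm::finite"
  shows "infnorm (A *v v) \<le> (onorm ((*v) A) * sqrt DIM(real ^ 'n)) * infnorm v"
proof -
  have "infnorm (A *v v) \<le> onorm ((*v) A) * norm v"
    using infnorm_le_norm norm_matrix_vector_mult_le by (rule order_trans)
  also have "\<dots> \<le> onorm ((*v) A) * (sqrt DIM(real ^ 'n) * infnorm v)"
    by (intro mult_left_mono norm_le_infnorm onorm_matrix_nonneg)
  finally show ?thesis by (simp add: mult.assoc)
qed

lemma matrix_norm_inf_nonneg: "0 \<le> matrix_norm_inf (A :: real ^ 'n::finite ^ 'm::finite)"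
  by (rule induced_norm_nonneg) (rule infnorm_pos_le infnorm_matrix_vector_mult_le_infnorm)+

lemma matrix_norm_inf_bound:
  "infnorm ((A :: real ^ 'n::finite ^ 'm::finite) *v v) \<le> matrix_norm_inf A * infnorm v"
  by (rule induced_norm_bound) (rule infnorm_pos_le infnorm_matrix_vector_mult_le_infnorm)+

section \<open>Bounds for the gates\<close>

lemma hconcat_mult:
  fixes W :: "real ^ 'u::finite ^ 'x::finite"
  shows "hconcat W U b *v (\<chi> j. case j of Inl l \<Rightarrow> u $ l | Inr (Inl l) \<Rightarrow> \<xi> $ l | Inr (Inr _) \<Rightarrow> 1)
    = W *v u + U *v \<xi> + b"
  by (simp add: vec_eq_iff hconcat_def matrix_vector_mult_def UNIV_Plus_UNIV[symmetric]
      sum.Plus UNIV_unit del: UNIV_Plus_UNIV)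

text \<open>A constant entry 1 stacked under \<open>u\<close> and \<open>\<xi>\<close> makes the
  affine argument of the gate linear. The stacked vector lies in the unit cube, so every entry of
  its image under \<open>[W U b]\<close> is at most the induced norm, and the sigmoid is
  monotone.\<close>

lemma gate_bound:
  fixes W :: "real ^ 'u::finite ^ 'x::finite"
  assumes u: "u \<in> input_set" and \<xi>: "\<And>i. \<bar>\<xi> $ i\<bar> \<le> 1"
  shows "map_vec sigmoid (W *v u + U *v \<xi> + b) $ i \<le> sigmoid (matrix_norm_inf (hconcat W U b))"
proof -
  let ?A = "hconcat W U b"
  define z :: "real ^ ('u + 'x + unit)" where
    "z = (\<chi> j. case j of Inl l \<Rightarrow> u $ l | Inr (Inl l) \<Rightarrow> \<xi> $ l | Inr (Inr _) \<Rightarrow> 1)"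
  have "\<bar>z $ j\<bar> \<le> 1" for j
    using u \<xi> unfolding z_def input_set_def by (auto split: sum.split simp: abs_le_iff minus_le_iff)
  then have "infnorm z \<le> 1"
    unfolding infnorm_cart by (intro cSup_least) auto
  then have "matrix_norm_inf ?A * infnorm z \<le> matrix_norm_inf ?A"
    using matrix_norm_inf_nonneg[of ?A] by (rule mult_left_le)
  moreover have "\<bar>(?A *v z) $ i\<bar> \<le> infnorm (?A *v z)"
    by (rule component_le_infnorm_cart)
  ultimately have "(W *v u + U *v \<xi> + b) $ i \<le> matrix_norm_inf ?A"
    using matrix_norm_inf_bound[of ?A z] hconcat_mult[of W U b u \<xi>] unfolding z_def by simp
  then show ?thesis
    unfolding map_vec_def by (simp add: sigmoid_mono)
qed

section \<open>One step of the network in the 1-norm\<close>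

lemma norm1_map_vec_tanh_le: "norm1 (map_vec tanh v) \<le> norm1 v"
  unfolding norm1_def map_vec_def by (auto intro: sum_mono abs_tanh_le_abs)

text \<open>Sigmoids are positive, so an upper bound for the entries of a gate also bounds their
  absolute values.\<close>

lemma norm1_gate_le:
  assumes "\<And>i. map_vec sigmoid v $ i \<le> s"
  shows "norm1 (map_vec sigmoid v * w) \<le> s * norm1 w"
  unfolding norm1_def sum_distrib_left
proof (rule sum_mono)
  fix i
  have "0 < map_vec sigmoid v $ i"
    by (simp add: map_vec_def sigmoid_pos)
  then show "\<bar>(map_vec sigmoid v * w) $ i\<bar> \<le> s * \<bar>w $ i\<bar>"
    using assms[of i] by (simp add: abs_mult mult_right_mono)
qed

text \<open>The gate bounds are parameters because the first step uses 1 and later steps use the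
  sigmoids of the norms. Since \<open>\<bar>tanh t\<bar> \<le> \<bar>t\<bar>\<close>, the new
  \<open>\<xi>\<close> is at most \<open>so\<close> times the new \<open>x\<close> in 1-norm, which
  produces the factor \<open>1 + so\<close> of both hypotheses.\<close>

lemma lstm_step_bound:
  assumes f: "\<And>i. map_vec sigmoid (W_f N *v u + U_f N *v \<xi> + b_f N) $ i \<le> sf"
    and i: "\<And>i. map_vec sigmoid (W_i N *v u + U_i N *v \<xi> + b_i N) $ i \<le> si"
    and o: "\<And>i. map_vec sigmoid (W_o N *v u + U_o N *v \<xi> + b_o N) $ i \<le> so"
    and pos: "0 \<le> si" "0 \<le> so"
  shows "norm1 (fst (lstm_step N u b_c (x, \<xi>))) + norm1 (snd (lstm_step N u b_c (x, \<xi>)))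
    \<le> (1 + so) * (sf * norm1 x
        + si * (norm1 (W_c N *v u) + matrix_norm_1 (U_c N) * norm1 \<xi> + norm1 b_c))"
proof -
  let ?g = "W_c N *v u + U_c N *v \<xi> + b_c"
  let ?x' = "fst (lstm_step N u b_c (x, \<xi>))"
  let ?o = "W_o N *v u + U_o N *v \<xi> + b_o N"
  have "norm1 (map_vec tanh ?g) \<le> norm1 ?g"
    by (rule norm1_map_vec_tanh_le)
  also have "\<dots> \<le> norm1 (W_c N *v u) + norm1 (U_c N *v \<xi>) + norm1 b_c"
    using norm1_triangle[of "W_c N *v u + U_c N *v \<xi>" b_c]
      norm1_triangle[of "W_c N *v u" "U_c N *v \<xi>"] by linarith
  also have "\<dots> \<le> norm1 (W_c N *v u) + matrix_norm_1 (U_c N) * norm1 \<xi> + norm1 b_c"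
    using matrix_norm_1_bound[of "U_c N" \<xi>] by simp
  finally have g: "norm1 (map_vec tanh ?g) \<le> \<dots>" .
  have "norm1 ?x' \<le> sf * norm1 x + si * norm1 (map_vec tanh ?g)"
    unfolding lstm_step_def Let_def case_prod_conv fst_conv
    by (rule order_trans[OF norm1_triangle]) (intro add_mono norm1_gate_le f i)
  then have x': "norm1 ?x' \<le> sf * norm1 x
      + si * (norm1 (W_c N *v u) + matrix_norm_1 (U_c N) * norm1 \<xi> + norm1 b_c)" (is "_ \<le> ?B")
    using mult_left_mono[OF g pos(1)] by linarith
  have "snd (lstm_step N u b_c (x, \<xi>)) = map_vec sigmoid ?o * map_vec tanh ?x'"
    by (simp add: lstm_step_def Let_def)
  then have "norm1 (snd (lstm_step N u b_c (x, \<xi>))) \<le> so * norm1 (map_vec tanh ?x')"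
    using norm1_gate_le[OF o] by simp
  also have "\<dots> \<le> so * norm1 ?x'"
    using norm1_map_vec_tanh_le pos(2) by (rule mult_left_mono)
  finally have "norm1 ?x' + norm1 (snd (lstm_step N u b_c (x, \<xi>))) \<le> (1 + so) * norm1 ?x'"
    by (simp add: distrib_right)
  also have "\<dots> \<le> (1 + so) * ?B"
    using x' pos(2) by (intro mult_left_mono) auto
  finally show ?thesis .
qed

lemma abs_snd_lstm_step_le_1: "\<bar>snd (lstm_step N u b_c \<chi>\<^sub>0) $ i\<bar> \<le> 1"
proof -
  have "\<bar>sigmoid s * tanh t\<bar> \<le> 1" for s t
    using sigmoid_pos[of s] sigmoid_le_1[of s] abs_tanh_le_1[of t]
    by (simp add: abs_mult mult_le_one)
  then show ?thesis
    by (cases \<chi>\<^sub>0) (simp add: lstm_step_def Let_def map_vec_def)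
qed

text \<open>Time 0 is excluded since the initial \<open>\<xi>\<close> is arbitrary; every later one
  is a sigmoid times a tanh in each entry.\<close>

lemma abs_snd_lstm_state_le_1: "0 < k \<Longrightarrow> \<bar>snd (lstm_state N k \<chi>\<^sub>0 u b_c) $ i\<bar> \<le> 1"
  by (cases k) (simp_all add: abs_snd_lstm_step_le_1)

section \<open>Bounded inputs and iteration of the one-step estimate\<close>

lemma norm_le_seq_norm:
  fixes u :: "nat \<Rightarrow> real ^ 'u::finite"
  assumes "\<And>j. u j \<in> input_set"
  shows "norm (u k) \<le> seq_norm u"
  unfolding seq_norm_def
proof (rule cSUP_upper)
  \<comment> \<open>The supremum is finite because all inputs lie in the unit cube.\<close>
  show "bdd_above (range (\<lambda>k. norm (u k)))"
  proof (rule bdd_aboveI2)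
    fix j
    have "\<bar>u j $ i\<bar> \<le> 1" for i
      using assms[of j] unfolding input_set_def by (auto simp: abs_le_iff minus_le_iff)
    then have "norm1 (u j) \<le> CARD('u)"
      unfolding norm1_def using sum_bounded_above[of UNIV "\<lambda>i. \<bar>u j $ i\<bar>" 1] by simp
    then show "norm (u j) \<le> CARD('u)"
      using norm_le_norm1 by (rule order_trans[rotated])
  qed
qed simp

text \<open>The offset \<open>w / (1 - \<rho>)\<close> is the fixed point of the map sending
  \<open>t\<close> to \<open>\<rho> * t + w\<close>, so the bound propagates by induction. The
  factor \<open>max 1 (M / \<rho>)\<close> is at least 1, as time 0 requires, and its product with
  \<open>\<rho>\<close> is at least \<open>M\<close>, as time 1 requires.\<close>

lemma perturbed_contraction_bound:
  fixes V :: "nat \<Rightarrow> real"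
  assumes \<rho>: "0 < \<rho>" "\<rho> < 1" and pos: "0 \<le> V 0" "0 \<le> w"
    and first: "V 1 \<le> M * V 0 + w"
    and step: "\<And>k. 0 < k \<Longrightarrow> V (Suc k) \<le> \<rho> * V k + w"
  shows "V k \<le> max 1 (M / \<rho>) * \<rho> ^ k * V 0 + w / (1 - \<rho>)"
proof (induction k)
  case 0
  have "1 * V 0 \<le> max 1 (M / \<rho>) * V 0"
    using pos by (intro mult_right_mono) auto
  moreover have "0 \<le> w / (1 - \<rho>)"
    using pos \<rho> by simp
  ultimately show ?case by simp
next
  case (Suc k)
  show ?case
  proof (cases "k = 0")
    case True
    have "M \<le> max 1 (M / \<rho>) * \<rho>"
      using mult_right_mono[of "M / \<rho>" "max 1 (M / \<rho>)" \<rho>] \<rho> by simp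
    then have "M * V 0 \<le> max 1 (M / \<rho>) * \<rho> * V 0"
      using pos(1) by (rule mult_right_mono)
    moreover have "w \<le> w / (1 - \<rho>)"
      using \<rho> pos by (simp add: le_divide_eq mult_left_le)
    ultimately show ?thesis using True first by simp
  next
    case False
    then have "V (Suc k) \<le> \<rho> * V k + w"
      by (simp add: step)
    also have "\<dots> \<le> \<rho> * (max 1 (M / \<rho>) * \<rho> ^ k * V 0 + w / (1 - \<rho>)) + w"
      using Suc.IH \<rho> by simp
    also have "\<dots> = max 1 (M / \<rho>) * \<rho> ^ Suc k * V 0 + w / (1 - \<rho>)"
      using \<rho> by (simp add: field_simps)
    finally show ?thesis .
  qed
qed

section \<open>Comparison functions\<close>

lemma class_Kinf_linear:
  assumes "0 < (a::real)"
  shows "class_Kinf (\<lambda>s. a * s)"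
proof -
  have "filterlim (\<lambda>s. a * s) at_top at_top"
    by (rule filterlim_tendsto_pos_mult_at_top[OF tendsto_const assms filterlim_ident])
  then show ?thesis
    unfolding class_Kinf_def class_K_def using assms
    by (auto intro!: continuous_intros strict_mono_onI)
qed

text \<open>The time argument of a KL function is real, so the geometric decay is written with
  \<open>powr\<close>, which agrees with \<open>\<rho> ^ k\<close> at natural numbers.\<close>

lemma class_KL_exponential:
  assumes "0 < (a::real)" "0 < \<rho>" "\<rho> < 1"
  shows "class_KL (\<lambda>s t. a * \<rho> powr t * s)"
  unfolding class_KL_def
proof (intro conjI allI impI)
  fix t :: real
  show "class_K (\<lambda>s. a * \<rho> powr t * s)"
    using class_Kinf_linear[of "a * \<rho> powr t"] assms unfolding class_Kinf_def by simp
next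
  fix s :: real assume s: "0 \<le> s"
  show "antimono_on {0..} (\<lambda>t. a * \<rho> powr t * s)"
    using assms s by (intro monotone_onI mult_right_mono mult_left_mono powr_mono') auto
  have "((\<lambda>t. \<rho> powr t) \<longlongrightarrow> 0) at_top"
  proof -
    \<comment> \<open>This is \<open>\<rho> powr t\<close> in exponential form;
      \<open>ln \<rho> < 0\<close> drives the exponent to minus infinity.\<close>
    have "((\<lambda>t. exp (ln \<rho> * t)) \<longlongrightarrow> 0) at_top"
      using assms
      by (intro filterlim_compose[OF exp_at_bot]
          filterlim_tendsto_neg_mult_at_bot[OF tendsto_const _ filterlim_ident]) simp
    then show ?thesis
      using assms by (simp add: powr_def mult.commute)
  qed
  then have "((\<lambda>t. a * \<rho> powr t * s) \<longlongrightarrow> a * 0 * s) at_top"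
    by (intro tendsto_intros)
  then show "((\<lambda>t. a * \<rho> powr t * s) \<longlongrightarrow> 0) at_top" by simp
qed

section \<open>Assembly of the input-to-state estimate\<close>

theorem theorem4:
  fixes N :: "('u::finite, 'x::finite, 'y::finite) lstm"
  assumes "(1 + sigmoid (matrix_norm_inf (hconcat (W_o N) (U_o N) (b_o N))))
             * sigmoid (matrix_norm_inf (hconcat (W_f N) (U_f N) (b_f N))) < 1"
    and "(1 + sigmoid (matrix_norm_inf (hconcat (W_o N) (U_o N) (b_o N))))
             * sigmoid (matrix_norm_inf (hconcat (W_i N) (U_i N) (b_i N)))
             * matrix_norm_1 (U_c N) < 1"
  shows "\<exists>\<beta> \<gamma>\<^sub>u \<gamma>\<^sub>b. class_KL \<beta> \<and> class_Kinf \<gamma>\<^sub>u \<and> class_Kinf \<gamma>\<^sub>b \<and>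
    (\<forall>(k::nat) (\<chi>\<^sub>0 :: (real ^ 'x) \<times> (real ^ 'x)) (b_c :: real ^ 'x) (u :: nat \<Rightarrow> real ^ 'u).
      (\<forall>j. u j \<in> input_set) \<longrightarrow>
      norm (lstm_state N k \<chi>\<^sub>0 u b_c)
        \<le> \<beta> (norm \<chi>\<^sub>0) (real k) + \<gamma>\<^sub>u (seq_norm u) + \<gamma>\<^sub>b (norm b_c))"
proof -
  define so where "so = sigmoid (matrix_norm_inf (hconcat (W_o N) (U_o N) (b_o N)))"
  define sf where "sf = sigmoid (matrix_norm_inf (hconcat (W_f N) (U_f N) (b_f N)))"
  define si where "si = sigmoid (matrix_norm_inf (hconcat (W_i N) (U_i N) (b_i N)))"
  define m where "m = matrix_norm_1 (U_c N)"
  define \<rho> where "\<rho> = max ((1 + so) * sf) ((1 + so) * si * m)"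
  \<comment> \<open>Growth factor of the first step: with all gates bounded by 1, the coefficient of
    \<open>x\<close> is 2 and that of \<open>\<xi>\<close> is \<open>2 * m\<close>.\<close>
  define M where "M = 2 * max 1 m"
  define L where "L = max 1 (M / \<rho>)"
  \<comment> \<open>The summand 1 keeps \<open>c\<close> positive even if \<open>W_c N\<close> is
    zero, as the gain for \<open>u\<close> must be strictly increasing.\<close>
  define c where "c = CARD('x) * onorm ((*v) (W_c N)) + 1"
  define n where "n = real CARD('x)"
  have s: "0 < so" "so \<le> 1" "0 < sf" "0 < si" "si \<le> 1"
    by (simp_all add: so_def sf_def si_def sigmoid_pos sigmoid_le_1)
  \<comment> \<open>Positivity comes from the first entry of the maximum; the second is 0 when
    \<open>m\<close> is.\<close>
  have \<rho>: "0 < \<rho>" "\<rho> < 1"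
    using assms s
    unfolding \<rho>_def so_def[symmetric] sf_def[symmetric] si_def[symmetric] m_def[symmetric]
    by (auto simp: less_max_iff_disj)
  have "0 < L" "0 < n"
    by (auto simp: L_def n_def)
  have c: "0 < c" and Wc: "norm1 (W_c N *v v) \<le> c * norm v" for v
    using onorm_matrix_nonneg[of "W_c N"] norm1_matrix_vector_mult_le[of "W_c N" v]
    by (auto simp: c_def distrib_right intro: add_nonneg_pos add_increasing2)
  have m: "0 \<le> m"
    unfolding m_def by (rule matrix_norm_1_nonneg)
  have bound: "norm (lstm_state N k \<chi>\<^sub>0 u b_c)
      \<le> (L * (2 * n)) * \<rho> powr real k * norm \<chi>\<^sub>0
        + 2 * c / (1 - \<rho>) * seq_norm u + 2 * n / (1 - \<rho>) * norm b_c"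
    if u: "\<forall>j. u j \<in> input_set" for k \<chi>\<^sub>0 b_c and u :: "nat \<Rightarrow> real ^ 'u"
  proof -
    define V where "V k = norm1 (fst (lstm_state N k \<chi>\<^sub>0 u b_c)) + norm1 (snd (lstm_state N k \<chi>\<^sub>0 u b_c))"
      for k
    define w where "w = c * seq_norm u + n * norm b_c"
    have "0 \<le> seq_norm u"
      using u by (intro order_trans[OF norm_ge_zero norm_le_seq_norm]) simp
    then have w: "0 \<le> w"
      using c \<open>0 < n\<close> by (simp add: w_def)
    have input: "norm1 (W_c N *v u k) + norm1 b_c \<le> w" for k
    proof -
      have "c * norm (u k) \<le> c * seq_norm u"
        using u c by (intro mult_left_mono norm_le_seq_norm) auto
      then show ?thesis
        using Wc[of "u k"] norm1_le_norm[of b_c] unfolding w_def n_def by linarith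
    qed
    \<comment> \<open>Here \<open>x\<close>, \<open>y\<close> stand for the 1-norms of the two state
      blocks and \<open>a\<close>, \<open>b\<close> for those of \<open>W_c N *v u k\<close> and
      \<open>b_c\<close>. The perturbation \<open>a + b\<close> has coefficient
      \<open>(1 + so') * si' \<le> 2\<close>. It serves with \<open>r = \<rho>\<close> after the
      first step and with \<open>r = M\<close> in it.\<close>
    have gather: "(1 + so') * (sf' * x + si' * (a + m * y + b)) \<le> r * (x + y) + 2 * w"
      if "0 \<le> so'" "so' \<le> 1" "0 \<le> si'" "si' \<le> 1" "0 \<le> x" "0 \<le> y" "0 \<le> a + b" "a + b \<le> w"
        "(1 + so') * sf' \<le> r" "(1 + so') * si' * m \<le> r" for so' sf' si' x y a b r :: real
    proof -
      have "(1 + so') * si' * (a + b) \<le> 2 * w"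
        using that mult_mono[of "1 + so'" 2 si' 1] by (intro mult_mono) auto
      moreover have "(1 + so') * sf' * x \<le> r * x" "(1 + so') * si' * m * y \<le> r * y"
        using that by (auto intro: mult_right_mono)
      ultimately show ?thesis by (simp add: algebra_simps)
    qed
    have step: "V (Suc k) \<le> \<rho> * V k + 2 * w" if "0 < k" for k
    proof -
      obtain x \<xi> where \<chi>: "lstm_state N k \<chi>\<^sub>0 u b_c = (x, \<xi>)" by fastforce
      have "\<bar>\<xi> $ i\<bar> \<le> 1" for i
        using abs_snd_lstm_state_le_1[OF that, of N \<chi>\<^sub>0 u b_c i] \<chi> by simp
      \<comment> \<open>The bound on \<open>\<xi>\<close>, available from time 1 on, brings in the
        gate norms of the hypotheses.\<close>
      note gate = gate_bound[of "u k" \<xi>, OF u[rule_format] this]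
      have "V (Suc k) \<le> (1 + so) * (sf * norm1 x + si * (norm1 (W_c N *v u k) + m * norm1 \<xi> + norm1 b_c))"
        unfolding V_def lstm_state.simps \<chi> m_def
        by (rule lstm_step_bound) (use s in \<open>auto simp: so_def sf_def si_def gate\<close>)
      also have "\<dots> \<le> \<rho> * (norm1 x + norm1 \<xi>) + 2 * w"
        by (rule gather) (use s input[of k] in \<open>auto simp: \<rho>_def norm1_nonneg\<close>)
      finally show ?thesis by (simp add: V_def \<chi>)
    qed
    obtain x \<xi> where \<chi>: "\<chi>\<^sub>0 = (x, \<xi>)" by fastforce
    have "V 1 \<le> (1 + 1) * (1 * norm1 x + 1 * (norm1 (W_c N *v u 0) + m * norm1 \<xi> + norm1 b_c))"
      unfolding V_def lstm_state.simps \<chi> m_def One_nat_def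
      by (rule lstm_step_bound) (auto simp: map_vec_def sigmoid_le_1)
    also have "\<dots> \<le> M * (norm1 x + norm1 \<xi>) + 2 * w"
      by (rule gather) (use input[of 0] in \<open>auto simp: M_def norm1_nonneg\<close>)
    finally have first: "V 1 \<le> M * V 0 + 2 * w" by (simp add: V_def \<chi>)
    \<comment> \<open>Return to the Euclidean norm of the stacked initial state: each of the two
      blocks contributes a factor \<open>n\<close>.\<close>
    have "norm x \<le> norm \<chi>\<^sub>0" "norm \<xi> \<le> norm \<chi>\<^sub>0"
      using norm_fst_le[of x \<xi>] norm_snd_le[of \<xi> x] by (simp_all add: \<chi>)
    then have "n * norm x \<le> n * norm \<chi>\<^sub>0" "n * norm \<xi> \<le> n * norm \<chi>\<^sub>0"
      using \<open>0 < n\<close> by simp_all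
    moreover have "V 0 \<le> n * norm x + n * norm \<xi>"
      using norm1_le_norm[of x] norm1_le_norm[of \<xi>] by (simp add: V_def \<chi> n_def)
    ultimately have V0: "V 0 \<le> 2 * n * norm \<chi>\<^sub>0" by linarith
    have "norm (lstm_state N k \<chi>\<^sub>0 u b_c)
        \<le> norm (fst (lstm_state N k \<chi>\<^sub>0 u b_c)) + norm (snd (lstm_state N k \<chi>\<^sub>0 u b_c))"
      using norm_Pair_le[of "fst (lstm_state N k \<chi>\<^sub>0 u b_c)" "snd (lstm_state N k \<chi>\<^sub>0 u b_c)"] by simp
    also have "\<dots> \<le> V k"
      unfolding V_def by (intro add_mono norm_le_norm1)
    also have "\<dots> \<le> L * \<rho> ^ k * V 0 + 2 * w / (1 - \<rho>)"
      unfolding L_def using \<rho> w first step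
      by (intro perturbed_contraction_bound) (auto simp: V_def norm1_nonneg)
    also have "\<dots> \<le> L * \<rho> ^ k * (2 * n * norm \<chi>\<^sub>0) + 2 * w / (1 - \<rho>)"
      using V0 \<open>0 < L\<close> \<rho> by (intro add_right_mono mult_left_mono) auto
    \<comment> \<open>Expanding \<open>w\<close> separates the gain for \<open>u\<close> from the
      gain for \<open>b_c\<close>.\<close>
    also have "\<dots> = (L * (2 * n)) * \<rho> powr real k * norm \<chi>\<^sub>0
        + 2 * c / (1 - \<rho>) * seq_norm u + 2 * n / (1 - \<rho>) * norm b_c"
      using \<rho> by (simp add: w_def powr_realpow distrib_left add_divide_distrib mult_ac)
    finally show ?thesis .
  qed
  show ?thesis
  proof (intro exI conjI)
    show "class_KL (\<lambda>s t. (L * (2 * n)) * \<rho> powr t * s)"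
      using \<rho> \<open>0 < L\<close> \<open>0 < n\<close> by (intro class_KL_exponential) auto
    show "class_Kinf (\<lambda>s. 2 * c / (1 - \<rho>) * s)"
      using \<rho> c by (intro class_Kinf_linear) auto
    show "class_Kinf (\<lambda>s. 2 * n / (1 - \<rho>) * s)"
      using \<rho> \<open>0 < n\<close> by (intro class_Kinf_linear) auto
  qed (use bound in blast)
qed

end
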